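(* Let $f=\sec(2x)$, $g=2\tan(2x)$, $h=\tan(2x)$, $D=d/dx$, and $\imath=\sqrt{-1}$. For every integer $n\ge1$, $$(fD)^n(f)=n!\,f^{n+1}(-\imath)^nL_n(\imath h),$$ $$(fD)^n(g)=2(n+1)!\,f^{n+2}(-\imath)^{n-1}N_n(\imath h).$$
   Context: The operator $fD$ sends a function $\phi$ of $x$ to $f\cdot D(\phi)$, and $(fD)^{n+1}(\phi)=f\,D\big((fD)^n(\phi)\big)$. Functions are considered where $\cos 2x\neq 0$. The polynomials $N_n$ and $L_n$ are $$N_n(x)=\frac1n\sum_{k=0}^{n-1}\binom nk\binom n{k+1}(x+1)^k(x-1)^{n-1-k},\qquad L_n(x)=\sum_{k=0}^n\binom nk^2(x+1)^k(x-1)^{n-k}.$$ (Here $\frac1{2^n}L_n(x)$ is the Legendre polynomial.) *)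

theory Defs
  imports "HOL-Analysis.Analysis"
begin

definition sec :: "'a::{real_normed_field,banach} \<Rightarrow> 'a" where
  "sec x = inverse (cos x)"

text \<open>
  The operator \<open>fD\<close>. The library's \<^const>\<open>deriv\<close> is total, with an unspecified value where the
  function is not differentiable. Iterates of the operator on a function are
  \<open>(weighted_deriv f ^^ n) \<phi>\<close>; their values at a point \<open>x\<close> depend only on \<open>f\<close> and \<open>\<phi>\<close> near \<open>x\<close>, so
  they are the intended ones wherever \<open>f\<close> and \<open>\<phi>\<close> are smooth in a neighbourhood of \<open>x\<close>.
\<close>
definition weighted_deriv ::
    "('a::real_normed_field \<Rightarrow> 'a) \<Rightarrow> ('a \<Rightarrow> 'a) \<Rightarrow> 'a \<Rightarrow> 'a" where
  "weighted_deriv f \<phi> = (\<lambda>x. f x * deriv \<phi> x)"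

definition N_poly :: "nat \<Rightarrow> 'a::field_char_0 \<Rightarrow> 'a" where
  "N_poly n x =
     1 / of_nat n *
       (\<Sum>k = 0..n - 1. of_nat (n choose k) * of_nat (n choose (k + 1)) *
                       (x + 1) ^ k * (x - 1) ^ (n - 1 - k))"

definition L_poly :: "nat \<Rightarrow> 'a::field_char_0 \<Rightarrow> 'a" where
  "L_poly n x = (\<Sum>k = 0..n. of_nat (n choose k) ^ 2 * (x + 1) ^ k * (x - 1) ^ (n - k))"

end

theory Submission
  imports Defs
begin

text \<open>
  Put \<open>A = \<i> h + 1\<close> and \<open>B = \<i> h - 1\<close>. Since \<open>f\<^sup>2 = 1 + h\<^sup>2 = - A B\<close>, we have
  \<open>A' = B' = - 2 \<i> A B\<close> and \<open>f' = - \<i> (A + B) f\<close>, so \<open>fD\<close> sends \<open>f\<^sup>m A\<^sup>k B\<^sup>j\<close> to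
  \<open>- \<i> f\<^bsup>m+1\<^esup> A\<^sup>k B\<^sup>j ((m + 2 j) A + (m + 2 k) B)\<close>. Both formulas follow by induction on \<open>n\<close>
  from the resulting two-term recurrences for the squared binomial coefficients and for the
  Narayana numbers.
\<close>

section \<open>Differentiating homogeneous sums in \<open>A\<close> and \<open>B\<close> with a
  power of \<open>sec\<close> as factor\<close>

lemma of_real_deriv_eq:
  fixes \<phi> :: "real \<Rightarrow> real" and \<Phi> :: "real \<Rightarrow> complex"
  assumes U: "open U" "x \<in> U"
    and eq: "\<And>t. t \<in> U \<Longrightarrow> complex_of_real (\<phi> t) = \<Phi> t"
    and der: "(\<Phi> has_vector_derivative D) (at x)"
  shows "complex_of_real (deriv \<phi> x) = D"
proof -
  \<comment> \<open>Differentiability of \<open>\<phi>\<close> is inherited from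
    \<open>\<Phi>\<close> by taking real parts. The imaginary part of the embedded
    \<open>\<phi>\<close> is the zero function, so \<open>D\<close> is real.\<close>
  have ofr: "((\<lambda>t. complex_of_real (\<phi> t)) has_vector_derivative D) (at x)"
    using has_vector_derivative_transform_within_open[OF der U] eq by simp
  have "((\<lambda>t. Re (complex_of_real (\<phi> t))) has_vector_derivative Re D) (at x)"
    by (rule bounded_linear.has_vector_derivative[OF bounded_linear_Re ofr])
  then have "(\<phi> has_real_derivative Re D) (at x)"
    by (simp add: has_real_derivative_iff_has_vector_derivative)
  then have re: "deriv \<phi> x = Re D"
    by (rule DERIV_imp_deriv)
  have "((\<lambda>t. Im (complex_of_real (\<phi> t))) has_vector_derivative Im D) (at x)"
    by (rule bounded_linear.has_vector_derivative[OF bounded_linear_Im ofr])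
  then have "((\<lambda>t. 0) has_vector_derivative Im D) (at x)"
    by simp
  then have "Im D = 0"
    using has_vector_derivative_const vector_derivative_unique_at by blast
  with re show ?thesis
    by (simp add: complex_eq_iff)
qed

lemma open_cos_double_nonzero: "open {t::real. cos (2 * t) \<noteq> 0}"
  by (intro open_Collect_neq continuous_intros)

text \<open>The induction step shared by both formulas. Each summand of degree \<open>d\<close> in
  \<open>A\<close> and \<open>B\<close> yields two of degree \<open>Suc d\<close>, so the
  coefficient at \<open>A ^ Suc k\<close> collects contributions from the indices
  \<open>Suc k\<close> and \<open>k\<close>: this is the recurrence for \<open>b\<close>. The
  convention \<open>a (Suc d) = 0\<close> covers the top index \<open>k = d\<close>, and
  \<open>b 0\<close> has a single source.\<close>

lemma weighted_deriv_sec_tan_sum: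
  fixes \<phi> :: "real \<Rightarrow> real" and a b :: "nat \<Rightarrow> complex" and C :: complex and m d :: nat
  defines "F \<equiv> \<lambda>t. complex_of_real (sec (2 * t))"
    and "A \<equiv> \<lambda>t. \<i> * complex_of_real (tan (2 * t)) + 1"
    and "B \<equiv> \<lambda>t. \<i> * complex_of_real (tan (2 * t)) - 1"
  assumes eq: "\<And>t. cos (2 * t) \<noteq> 0 \<Longrightarrow>
      complex_of_real (\<phi> t) = C * F t ^ m * (\<Sum>k\<le>d. a k * A t ^ k * B t ^ (d - k))"
    and a: "a (Suc d) = 0"
    and b0: "b 0 = of_nat m * a 0"
    and bSuc: "\<And>k. k \<le> d \<Longrightarrow>
      b (Suc k) = of_nat (m + 2 * Suc k) * a (Suc k) + of_nat (m + 2 * (d - k)) * a k"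
    and x: "cos (2 * x) \<noteq> 0"
  shows "complex_of_real (weighted_deriv (\<lambda>t. sec (2 * t)) \<phi> x) =
      C * (- \<i>) * F x ^ Suc m * (\<Sum>k\<le>Suc d. b k * A x ^ k * B x ^ (Suc d - k))"
proof -
  have "sec (2 * x) ^ 2 = 1 + tan (2 * x) ^ 2"
    using x tan_sec[of "2 * x"] by (simp add: sec_def)
  then have F2: "F x ^ 2 = - A x * B x"
    unfolding F_def A_def B_def
    by (simp add: algebra_simps power2_eq_square flip: of_real_mult of_real_add)
      (metis of_real_1 of_real_add)
  have "((\<lambda>t. sec (2 * t)) has_real_derivative 2 * tan (2 * x) * sec (2 * x)) (at x)"
    unfolding sec_def tan_def using x
    by (auto intro!: derivative_eq_intros simp: field_simps power2_eq_square)
  then have "(F has_vector_derivative of_real (2 * tan (2 * x) * sec (2 * x))) (at x)"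
    unfolding F_def by (intro has_vector_derivative_of_real)
      (simp add: has_real_derivative_iff_has_vector_derivative)
  also have "of_real (2 * tan (2 * x) * sec (2 * x)) = - \<i> * (A x + B x) * F x"
    by (simp add: F_def A_def B_def algebra_simps)
  finally have dF: "(F has_vector_derivative - \<i> * (A x + B x) * F x) (at x)" .
  have "((\<lambda>t. tan (2 * t)) has_real_derivative 2 * sec (2 * x) ^ 2) (at x)"
    using x by (auto intro!: derivative_eq_intros simp: sec_def power_inverse)
  then have dh: "((\<lambda>t. complex_of_real (tan (2 * t))) has_vector_derivative
      of_real (2 * sec (2 * x) ^ 2)) (at x)"
    by (intro has_vector_derivative_of_real)
      (simp add: has_real_derivative_iff_has_vector_derivative)
  have D: "\<i> * of_real (2 * sec (2 * x) ^ 2) = - 2 * \<i> * A x * B x"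
    using F2 by (simp add: F_def)
  have dih: "((\<lambda>t. \<i> * complex_of_real (tan (2 * t))) has_vector_derivative
      - 2 * \<i> * A x * B x) (at x)"
    using has_vector_derivative_mult_right[OF dh, of \<i>] unfolding D .
  have dA: "(A has_vector_derivative - 2 * \<i> * A x * B x) (at x)"
    using has_vector_derivative_add[OF dih has_vector_derivative_const[of 1]]
    by (simp add: A_def)
  have dB: "(B has_vector_derivative - 2 * \<i> * A x * B x) (at x)"
    using has_vector_derivative_diff[OF dih has_vector_derivative_const[of 1]]
    by (simp add: B_def)
  have dpow: "((\<lambda>t. G t ^ k) has_vector_derivative of_nat k * G x ^ (k - 1) * G') (at x)"
    if "(G has_vector_derivative G') (at x)" for G :: "real \<Rightarrow> complex" and G' k
  proof -
    have "((\<lambda>z. z ^ k) has_field_derivative of_nat k * G x ^ (k - 1)) (at (G x))"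
      by (auto intro!: derivative_eq_intros)
    from field_vector_diff_chain_at[OF that this] show ?thesis
      by (simp add: o_def mult_ac)
  qed
  \<comment> \<open>At \<open>k = 0\<close> the exponent \<open>k - 1\<close> is truncated to 0, but
    the factor \<open>of_nat k\<close> makes both sides vanish.\<close>
  have pred: "of_nat k * z ^ (k - 1) * z = of_nat k * z ^ k" for k and z :: complex
    by (cases k) auto
  \<comment> \<open>\<open>F x ^ m * T k\<close> will be the derivative of the \<open>k\<close>-th
    summand; the operator supplies the one further factor \<open>F x\<close>.\<close>
  define T where "T = (\<lambda>k. - \<i> * a k * (of_nat (m + 2 * (d - k)) * A x ^ Suc k * B x ^ (d - k)
      + of_nat (m + 2 * k) * A x ^ k * B x ^ Suc (d - k)))"
  have dterm: "((\<lambda>t. F t ^ m * (a k * A t ^ k * B t ^ (d - k))) has_vector_derivative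
      F x ^ m * T k) (at x)" for k
  proof -
    define j where "j = d - k"
    have "((\<lambda>t. F t ^ m * (A t ^ k * B t ^ j)) has_vector_derivative
        F x ^ m * (A x ^ k * (of_nat j * B x ^ (j - 1) * (- 2 * \<i> * A x * B x))
          + of_nat k * A x ^ (k - 1) * (- 2 * \<i> * A x * B x) * B x ^ j)
        + of_nat m * F x ^ (m - 1) * (- \<i> * (A x + B x) * F x) * (A x ^ k * B x ^ j)) (at x)"
      by (intro has_vector_derivative_mult dpow dF dA dB)
    \<comment> \<open>The derivatives of \<open>A\<close>, \<open>B\<close> and \<open>F\<close> are
      multiples of \<open>A\<close>, \<open>B\<close> and \<open>F\<close> respectively. Regrouping
      puts this factor next to the lowered power, so that \<open>pred\<close> restores the
      exponents.\<close>
    also have "F x ^ m * (A x ^ k * (of_nat j * B x ^ (j - 1) * (- 2 * \<i> * A x * B x))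
          + of_nat k * A x ^ (k - 1) * (- 2 * \<i> * A x * B x) * B x ^ j)
        + of_nat m * F x ^ (m - 1) * (- \<i> * (A x + B x) * F x) * (A x ^ k * B x ^ j) =
        F x ^ m * (A x ^ k * ((of_nat j * B x ^ (j - 1) * B x) * (- 2 * \<i> * A x))
          + (of_nat k * A x ^ (k - 1) * A x) * (- 2 * \<i> * B x) * B x ^ j)
        + (of_nat m * F x ^ (m - 1) * F x) * (- \<i> * (A x + B x)) * (A x ^ k * B x ^ j)"
      by (simp add: algebra_simps)
    also have "\<dots> = F x ^ m * (- \<i> * (of_nat (m + 2 * j) * A x ^ Suc k * B x ^ j
      + of_nat (m + 2 * k) * A x ^ k * B x ^ Suc j))"
      unfolding pred by (simp add: algebra_simps)
    finally have "((\<lambda>t. a k * (F t ^ m * (A t ^ k * B t ^ j))) has_vector_derivative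
      a k * (F x ^ m * (- \<i> * (of_nat (m + 2 * j) * A x ^ Suc k * B x ^ j
      + of_nat (m + 2 * k) * A x ^ k * B x ^ Suc j)))) (at x)"
      by (rule has_vector_derivative_mult_right)
    then show ?thesis
      by (simp add: T_def j_def mult_ac)
  qed
  have "((\<lambda>t. C * (\<Sum>k\<le>d. F t ^ m * (a k * A t ^ k * B t ^ (d - k)))) has_vector_derivative
      C * (\<Sum>k\<le>d. F x ^ m * T k)) (at x)"
    by (intro has_vector_derivative_mult_right has_vector_derivative_sum dterm)
  then have deriv: "complex_of_real (deriv \<phi> x) = C * (\<Sum>k\<le>d. F x ^ m * T k)"
    by (rule of_real_deriv_eq[OF open_cos_double_nonzero, rotated 2])
      (use x in \<open>simp_all add: eq sum_distrib_left mult_ac\<close>)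
  \<comment> \<open>The collection of like powers, read backwards: the sum over \<open>b\<close> is
    split by the recurrence, and its part in \<open>a (Suc k)\<close> is shifted back with the help
    of \<open>b 0\<close>.\<close>
  have "(\<Sum>k\<le>Suc d. b k * A x ^ k * B x ^ (Suc d - k)) =
      b 0 * B x ^ Suc d + (\<Sum>k\<le>d. b (Suc k) * A x ^ Suc k * B x ^ (d - k))"
    by (subst sum.atMost_Suc_shift) simp
  also have "(\<Sum>k\<le>d. b (Suc k) * A x ^ Suc k * B x ^ (d - k)) =
      (\<Sum>k\<le>d. of_nat (m + 2 * Suc k) * a (Suc k) * A x ^ Suc k * B x ^ (d - k))
      + (\<Sum>k\<le>d. of_nat (m + 2 * (d - k)) * a k * A x ^ Suc k * B x ^ (d - k))"
    unfolding sum.distrib[symmetric]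
    by (rule sum.cong) (simp_all only: bSuc atMost_iff distrib_right)
  also have "b 0 * B x ^ Suc d + \<dots> =
      (b 0 * B x ^ Suc d
        + (\<Sum>k\<le>d. of_nat (m + 2 * Suc k) * a (Suc k) * A x ^ Suc k * B x ^ (d - k)))
      + (\<Sum>k\<le>d. of_nat (m + 2 * (d - k)) * a k * A x ^ Suc k * B x ^ (d - k))"
    by (simp only: add.assoc)
  also have "b 0 * B x ^ Suc d
        + (\<Sum>k\<le>d. of_nat (m + 2 * Suc k) * a (Suc k) * A x ^ Suc k * B x ^ (d - k)) =
      (\<Sum>k\<le>Suc d. of_nat (m + 2 * k) * a k * A x ^ k * B x ^ (Suc d - k))"
    by (subst sum.atMost_Suc_shift) (simp add: b0)
  \<comment> \<open>The summand at \<open>Suc d\<close> drops out because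
    \<open>a (Suc d) = 0\<close>.\<close>
  also have "\<dots> = (\<Sum>k\<le>d. of_nat (m + 2 * k) * a k * A x ^ k * B x ^ Suc (d - k))"
    using a by (simp add: Suc_diff_le)
  finally have "(\<Sum>k\<le>Suc d. b k * A x ^ k * B x ^ (Suc d - k)) =
      (\<Sum>k\<le>d. of_nat (m + 2 * k) * a k * A x ^ k * B x ^ Suc (d - k)
        + of_nat (m + 2 * (d - k)) * a k * A x ^ Suc k * B x ^ (d - k))"
    unfolding sum.distrib .
  moreover have "T k = - \<i> * (of_nat (m + 2 * k) * a k * A x ^ k * B x ^ Suc (d - k)
        + of_nat (m + 2 * (d - k)) * a k * A x ^ Suc k * B x ^ (d - k))" for k
    by (simp only: T_def distrib_left mult_ac add.commute)
  ultimately have sum_T: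
    "(\<Sum>k\<le>d. T k) = - \<i> * (\<Sum>k\<le>Suc d. b k * A x ^ k * B x ^ (Suc d - k))"
    by (simp only: sum_distrib_left)
  have "complex_of_real (weighted_deriv (\<lambda>t. sec (2 * t)) \<phi> x) =
      F x * complex_of_real (deriv \<phi> x)"
    by (simp add: weighted_deriv_def F_def)
  also have "\<dots> = C * F x ^ Suc m * (\<Sum>k\<le>d. T k)"
    unfolding deriv sum_distrib_left[symmetric] by (simp only: power_Suc mult_ac)
  finally show ?thesis
    by (simp only: sum_T mult_ac)
qed

section \<open>Recurrences for squared binomial coefficients and Narayana numbers\<close>

lemma Suc_times_binomial_Suc_eq:
  fixes n k :: nat
  assumes "k \<le> n"
  shows "(of_nat k + 1) * of_nat (n choose Suc k) =
    (of_nat n - of_nat k) * (of_nat (n choose k) :: 'a::comm_ring_1)"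
proof -
  have "Suc k * (n choose Suc k) = (n - k) * (n choose k)"
    by (metis binomial_absorb_comp binomial_absorption)
  then have "of_nat (Suc k) * of_nat (n choose Suc k) =
      of_nat (n - k) * (of_nat (n choose k) :: 'a)"
    by (metis of_nat_mult)
  with assms show ?thesis
    by (simp add: of_nat_diff add.commute)
qed

text \<open>The coefficient recurrence for \<open>m = Suc n\<close> and \<open>d = n\<close>. By
  Pascal's rule the left side involves \<open>(p + q) ^ 2\<close>, and the two sides differ by
  \<open>2 * (p - q)\<close> times the relation between the neighbours \<open>p\<close> and
  \<open>q\<close>.\<close>

lemma binomial_square_recurrence:
  fixes n k :: nat
  assumes "k \<le> n"
  shows "of_nat (Suc n) * of_nat (Suc n choose Suc k) ^ 2 =
    of_nat (Suc n + 2 * Suc k) * of_nat (n choose Suc k) ^ 2 +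
    of_nat (Suc n + 2 * (n - k)) * (of_nat (n choose k) ^ 2 :: 'a::comm_ring_1)"
proof -
  define p q :: 'a where "p = of_nat (n choose k)" and "q = of_nat (n choose Suc k)"
  define N K :: 'a where "N = of_nat n" and "K = of_nat k"
  have "(K + 1) * q = (N - K) * p"
    using Suc_times_binomial_Suc_eq[OF assms] by (simp add: p_def q_def N_def K_def)
  moreover have "(N + 1) * (p + q) ^ 2 =
      (N + 1 + 2 * (K + 1)) * q ^ 2 + (N + 1 + 2 * (N - K)) * p ^ 2
      + 2 * (p - q) * ((K + 1) * q - (N - K) * p)"
    by (simp add: algebra_simps power2_eq_square)
  ultimately have "(N + 1) * (p + q) ^ 2 =
      (N + 1 + 2 * (K + 1)) * q ^ 2 + (N + 1 + 2 * (N - K)) * p ^ 2"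
    by simp
  with assms show ?thesis
    by (simp add: p_def q_def N_def K_def of_nat_diff algebra_simps)
qed

text \<open>Indexed from \<open>k = 0\<close>: this is the Narayana number usually written \<open>N(n, k + 1)\<close>.\<close>

definition narayana :: "nat \<Rightarrow> nat \<Rightarrow> 'a::field_char_0" where
  "narayana n k = of_nat (n choose k) * of_nat (n choose Suc k) / of_nat n"

lemma narayana_0 [simp]: "n > 0 \<Longrightarrow> narayana n 0 = 1"
  by (simp add: narayana_def)

text \<open>The coefficient recurrence for \<open>m = n + 2\<close> and \<open>d = n - 1\<close>.
  Three consecutive binomials have polynomial ratios in \<open>N\<close> and \<open>K\<close>;
  dividing by what the three products share leaves a polynomial identity.\<close>

lemma narayana_recurrence:
  fixes n k :: nat
  assumes "k < n"
  shows "of_nat (n + 2) * narayana (Suc n) (Suc k) =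
    of_nat (n + 2 + 2 * Suc k) * narayana n (Suc k) +
    of_nat (n + 2 + 2 * (n - 1 - k)) * (narayana n k :: 'a::field_char_0)"
proof -
  define p q r :: 'a where "p = of_nat (n choose k)" and "q = of_nat (n choose Suc k)"
    and "r = of_nat (n choose Suc (Suc k))"
  define N K :: 'a where "N = of_nat n" and "K = of_nat k"
  have pq: "(K + 1) * q = (N - K) * p"
    using Suc_times_binomial_Suc_eq[of k n] assms by (simp add: p_def q_def N_def K_def)
  have qr: "(K + 2) * r = (N - K - 1) * q"
    using Suc_times_binomial_Suc_eq[of "Suc k" n] assms
    by (simp add: q_def r_def N_def K_def algebra_simps)
  have "N - K = of_nat (n - k)" "K + 2 = of_nat (k + 2)" "N + 1 = of_nat (Suc n)"
    using assms by (simp_all add: N_def K_def of_nat_diff)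
  with assms have nz: "N - K \<noteq> 0" "K + 2 \<noteq> 0" "N + 1 \<noteq> 0" "N \<noteq> 0"
    by (simp_all only: of_nat_eq_0_iff N_def)
  \<comment> \<open>\<open>c\<close> is chosen so that \<open>p\<close>, \<open>q\<close> and
    \<open>r\<close> are all polynomials in \<open>N\<close> and \<open>K\<close> times
    \<open>c\<close>; \<open>X\<close> is then a common factor of \<open>p * q\<close>,
    \<open>q * r\<close> and \<open>(p + q) * (q + r)\<close>.\<close>
  define c X where "c = q / ((N - K) * (K + 2))" and "X = (N - K) * (K + 2) * c ^ 2"
  have q: "q = (N - K) * (K + 2) * c"
    using nz by (simp add: c_def)
  have "(N - K) * p = (N - K) * ((K + 1) * (K + 2) * c)"
    unfolding pq[symmetric] by (simp only: q mult_ac)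
  then have p: "p = (K + 1) * (K + 2) * c"
    using nz by simp
  have "(K + 2) * r = (K + 2) * ((N - K - 1) * (N - K) * c)"
    unfolding qr by (simp only: q mult_ac)
  then have r: "r = (N - K - 1) * (N - K) * c"
    using nz by simp
  have pq_sum: "p + q = (N + 1) * (K + 2) * c" and qr_sum: "q + r = (N + 1) * (N - K) * c"
    unfolding p q r by (simp_all add: algebra_simps)
  have distr: "(u * v + w * z) * X / N = u * (v * X / N) + w * (z * X / N)" for u v w z
    by (simp add: distrib_right add_divide_distrib mult.assoc)
  have "(N + 2) * ((p + q) * (q + r) / (N + 1)) = (N + 2) * (N + 1) * X"
    unfolding pq_sum qr_sum X_def using nz by (simp add: power2_eq_square)
  also have "\<dots> = ((N + 2) * (N + 1) * N) * X / N"
    using nz by simp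
  \<comment> \<open>The polynomial identity to which the recurrence reduces.\<close>
  also have "(N + 2) * (N + 1) * N =
      (N + 2 + 2 * (K + 1)) * ((N - K - 1) * (N - K))
      + (N + 2 + 2 * (N - 1 - K)) * ((K + 1) * (K + 2))"
    by (simp add: algebra_simps)
  also have "\<dots> * X / N =
      (N + 2 + 2 * (K + 1)) * ((N - K - 1) * (N - K) * X / N)
      + (N + 2 + 2 * (N - 1 - K)) * ((K + 1) * (K + 2) * X / N)"
    by (rule distr)
  also have "(N - K - 1) * (N - K) * X = q * r"
    by (simp add: X_def q r power2_eq_square)
  also have "(K + 1) * (K + 2) * X = p * q"
    by (simp add: X_def p q power2_eq_square)
  finally have "(N + 2) * ((p + q) * (q + r) / (N + 1)) =
    (N + 2 + 2 * (K + 1)) * (q * r / N) + (N + 2 + 2 * (N - 1 - K)) * (p * q / N)" .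
  moreover have "of_nat (n - 1 - k) = N - 1 - K"
    using assms by (simp add: N_def K_def of_nat_diff)
  ultimately show ?thesis
    by (simp add: narayana_def p_def q_def r_def N_def K_def add_ac)
qed

section \<open>The two inductions on the number of applications of the operator\<close>

lemma L_poly_sum:
  "L_poly n y = (\<Sum>k\<le>n. of_nat (n choose k) ^ 2 * (y + 1) ^ k * (y - 1) ^ (n - k))"
  by (simp add: L_poly_def atMost_atLeast0)

lemma N_poly_Suc_sum:
  "N_poly (Suc d) y = (\<Sum>k\<le>d. narayana (Suc d) k * (y + 1) ^ k * (y - 1) ^ (d - k))"
  by (simp add: N_poly_def narayana_def atMost_atLeast0 sum_distrib_left mult_ac)

lemma iterated_weighted_deriv_sec:
  assumes "cos (2 * x) \<noteq> 0"
  shows "complex_of_real ((weighted_deriv (\<lambda>t. sec (2 * t)) ^^ n) (\<lambda>t. sec (2 * t)) x) =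
    fact n * complex_of_real (sec (2 * x)) ^ (n + 1) * (- \<i>) ^ n *
      L_poly n (\<i> * complex_of_real (tan (2 * x)))"
  using assms
proof (induction n arbitrary: x)
  case 0
  then show ?case by (simp add: L_poly_def)
next
  case (Suc n)
  let ?a = "\<lambda>k. of_nat (n choose k) ^ 2 :: complex"
  \<comment> \<open>The factor \<open>Suc n\<close> turns \<open>fact n\<close> into
    \<open>fact (Suc n)\<close>.\<close>
  let ?b = "\<lambda>k. of_nat (Suc n) * of_nat (Suc n choose k) ^ 2 :: complex"
  have "complex_of_real (weighted_deriv (\<lambda>t. sec (2 * t))
        ((weighted_deriv (\<lambda>t. sec (2 * t)) ^^ n) (\<lambda>t. sec (2 * t))) x) =
      (fact n * (- \<i>) ^ n) * (- \<i>) * complex_of_real (sec (2 * x)) ^ Suc (Suc n) *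
        (\<Sum>k\<le>Suc n. ?b k * (\<i> * complex_of_real (tan (2 * x)) + 1) ^ k *
          (\<i> * complex_of_real (tan (2 * x)) - 1) ^ (Suc n - k))"
    by (rule weighted_deriv_sec_tan_sum[where a = ?a])
      (use Suc in \<open>simp_all only: Suc.IH L_poly_sum binomial_square_recurrence\<close>,
        simp_all add: mult_ac)
  then show ?case
    by (simp add: L_poly_sum sum_distrib_left mult_ac del: sum.atMost_Suc of_nat_Suc binomial_Suc_Suc)
qed

text \<open>The induction starts after one application, where the value is
  \<open>4 * sec (2 * x) ^ 3\<close> and \<open>N_poly 1\<close> is 1. Here \<open>d\<close> is the
  degree of the polynomial.\<close>

lemma iterated_weighted_deriv_tan:
  assumes "cos (2 * x) \<noteq> 0"
  shows "complex_of_real ((weighted_deriv (\<lambda>t. sec (2 * t)) ^^ Suc d) (\<lambda>t. 2 * tan (2 * t)) x) =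
    2 * fact (d + 2) * complex_of_real (sec (2 * x)) ^ (d + 3) * (- \<i>) ^ d *
      N_poly (Suc d) (\<i> * complex_of_real (tan (2 * x)))"
  using assms
proof (induction d arbitrary: x)
  case 0
  then have "((\<lambda>t. 2 * tan (2 * t)) has_real_derivative 4 * sec (2 * x) ^ 2) (at x)"
    by (auto intro!: derivative_eq_intros simp: sec_def power_inverse)
  then have "deriv (\<lambda>t. 2 * tan (2 * t)) x = 4 * sec (2 * x) ^ 2"
    by (rule DERIV_imp_deriv)
  then show ?case
    by (simp add: weighted_deriv_def N_poly_def eval_nat_numeral)
next
  case (Suc d)
  let ?a = "\<lambda>k. narayana (Suc d) k :: complex"
  \<comment> \<open>The factor \<open>d + 3\<close> is both the current exponent of
    \<open>sec\<close> and what turns \<open>fact (d + 2)\<close> into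
    \<open>fact (d + 3)\<close>.\<close>
  let ?b = "\<lambda>k. of_nat (d + 3) * narayana (Suc (Suc d)) k :: complex"
  have b: "?b (Suc k) = of_nat (d + 3 + 2 * Suc k) * ?a (Suc k) + of_nat (d + 3 + 2 * (d - k)) * ?a k"
    if "k \<le> d" for k
    using narayana_recurrence[of k "Suc d", where 'a = complex] that
    by (simp add: eval_nat_numeral)
  have "complex_of_real (weighted_deriv (\<lambda>t. sec (2 * t))
        ((weighted_deriv (\<lambda>t. sec (2 * t)) ^^ Suc d) (\<lambda>t. 2 * tan (2 * t))) x) =
      (2 * fact (d + 2) * (- \<i>) ^ d) * (- \<i>) * complex_of_real (sec (2 * x)) ^ Suc (d + 3) *
        (\<Sum>k\<le>Suc d. ?b k * (\<i> * complex_of_real (tan (2 * x)) + 1) ^ k *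
          (\<i> * complex_of_real (tan (2 * x)) - 1) ^ (Suc d - k))"
  proof (rule weighted_deriv_sec_tan_sum[where a = ?a])
    show "?a (Suc d) = 0"
      by (simp add: narayana_def binomial_eq_0)
  qed (use Suc b in \<open>simp_all only: Suc.IH N_poly_Suc_sum\<close>, simp_all add: mult_ac)
  moreover have "fact (Suc d + 2) = of_nat (d + 3) * (fact (d + 2) :: complex)"
    by (simp add: eval_nat_numeral)
  ultimately show ?case
    by (simp add: N_poly_Suc_sum sum_distrib_left mult_ac del: sum.atMost_Suc of_nat_Suc
        binomial_Suc_Suc fact_Suc of_nat_add)
qed

theorem corollary7:
  fixes f g h :: "real \<Rightarrow> real" and n :: nat and x :: real
  assumes f: "f = (\<lambda>t. sec (2 * t))"
    and g: "g = (\<lambda>t. 2 * tan (2 * t))"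
    and h: "h = (\<lambda>t. tan (2 * t))"
    and n: "n \<ge> 1"
    and x: "cos (2 * x) \<noteq> 0"
  shows "complex_of_real ((weighted_deriv f ^^ n) f x) =
           fact n * complex_of_real (f x) ^ (n + 1) * (- \<i>) ^ n *
             L_poly n (\<i> * complex_of_real (h x))
       \<and> complex_of_real ((weighted_deriv f ^^ n) g x) =
           2 * fact (n + 1) * complex_of_real (f x) ^ (n + 2) * (- \<i>) ^ (n - 1) *
             N_poly n (\<i> * complex_of_real (h x))"
proof -
  obtain d where d: "n = Suc d"
    using n by (cases n) auto
  show ?thesis
    using iterated_weighted_deriv_sec[OF x, of n] iterated_weighted_deriv_tan[OF x, of d]
    unfolding f g h d by (simp add: eval_nat_numeral)
qed

end
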